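(* Let $G$ be a finite simple connected graph with at least one edge, with maximum degree $\Delta$ and minimum degree $\delta$. Then $$\delta^{2}\cdot ID(G)\leq SDD(G)\leq \Delta^{2}\cdot ID(G).$$ Moreover, equality holds on the left if and only if $G$ is regular, and equality holds on the right if and only if $G$ is regular.
   Context: For a finite simple graph $G$ with vertex set $V_G$ and edge set $E_G$, $d_u$ denotes the degree of vertex $u$. The symmetric division deg index is $SDD(G)=\sum_{uv\in E_G}\left(\frac{d_u}{d_v}+\frac{d_v}{d_u}\right)$, and the inverse degree index is $ID(G)=\sum_{u\in V_G}\frac{1}{d_u}$. *)

theory Defs
  imports Complex_Main "Graph_Theory.Digraph_Component"
begin

text \<open>
  A finite simple graph is a symmetric digraph in the sense of locale \<^locale>\<open>graph\<close>: finite,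
  without loops and parallel arcs. Each undirected edge is a pair of opposite arcs, so the edge
  set \<open>E\<^sub>G\<close> consists of the unordered end pairs, and the degree of a vertex is its
  \<^const>\<open>out_degree\<close> (see \<open>out_degree_eq_card_incident\<close> below).
\<close>

definition edges :: "('a, 'b) pre_digraph \<Rightarrow> 'a set set" where
  "edges G = {{u, v} |u v. u \<rightarrow>\<^bsub>G\<^esub> v}"

lemma (in graph) out_degree_eq_card_incident:
  "out_degree G u = card {e \<in> edges G. u \<in> e}"
proof -
  have "bij_betw (\<lambda>a. {tail G a, head G a}) (out_arcs G u) {e \<in> edges G. u \<in> e}"
  proof (rule bij_betw_imageI)
    show "inj_on (\<lambda>a. {tail G a, head G a}) (out_arcs G u)"
      by (rule inj_onI, rule no_multi_arcs) (auto simp: arc_to_ends_def doubleton_eq_iff)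
    show "(\<lambda>a. {tail G a, head G a}) ` out_arcs G u = {e \<in> edges G. u \<in> e}"
    proof (intro equalityI subsetI)
      fix e assume "e \<in> (\<lambda>a. {tail G a, head G a}) ` out_arcs G u"
      then show "e \<in> {e \<in> edges G. u \<in> e}"
        by (fastforce simp: edges_def arcs_ends_conv)
    next
      fix e assume "e \<in> {e \<in> edges G. u \<in> e}"
      then obtain x y where e: "e = {x, y}" "x \<rightarrow> y" "u = x \<or> u = y"
        by (auto simp: edges_def)
      then have "\<exists>w. e = {u, w} \<and> u \<rightarrow> w"
        using arcs_ends_symmetric[OF sym_arcs] by blast
      then show "e \<in> (\<lambda>a. {tail G a, head G a}) ` out_arcs G u"
        by (auto simp: arcs_ends_conv image_iff)
    qed
  qed
  then show ?thesis
    by (simp add: out_degree_def bij_betw_same_card)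
qed

definition max_degree :: "('a, 'b) pre_digraph \<Rightarrow> nat" where
  "max_degree G = Max (out_degree G ` verts G)"

definition min_degree :: "('a, 'b) pre_digraph \<Rightarrow> nat" where
  "min_degree G = Min (out_degree G ` verts G)"

definition regular :: "('a, 'b) pre_digraph \<Rightarrow> bool" where
  "regular G \<longleftrightarrow> (\<exists>k. \<forall>u \<in> verts G. out_degree G u = k)"

text \<open>
  The inner double sum ranges over the two orderings of the ends of an edge; for \<open>e = {u, v}\<close>
  it is \<open>d\<^sub>u / d\<^sub>v + d\<^sub>v / d\<^sub>u\<close>, see \<open>SDD_edge_term\<close>.
\<close>

definition SDD :: "('a, 'b) pre_digraph \<Rightarrow> real" where
  "SDD G = (\<Sum>e \<in> edges G. \<Sum>u \<in> e. \<Sum>v \<in> e - {u}.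
      real (out_degree G u) / real (out_degree G v))"

lemma SDD_edge_term:
  fixes d :: "'a \<Rightarrow> real"
  assumes "u \<noteq> v"
  shows "(\<Sum>x \<in> {u, v}. \<Sum>y \<in> {u, v} - {x}. d x / d y) = d u / d v + d v / d u"
proof -
  have "{u, v} - {u} = {v}" "{u, v} - {v} = {u}"
    using assms by auto
  with assms show ?thesis by simp
qed

definition ID :: "('a, 'b) pre_digraph \<Rightarrow> real" where
  "ID G = (\<Sum>u \<in> verts G. 1 / real (out_degree G u))"

end

(* Summing over ordered adjacent pairs (u, v), SDD G is the sum of d_v / d_u and ID G is the
   sum of 1 / d_u^2, since u is the first entry of exactly d_u pairs. Hence SDD G - c * ID G is the
   sum of (d_u d_v - c) / d_u^2, and delta^2 <= d_u d_v <= Delta^2 makes every term have the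
   same sign for c = delta^2 and for c = Delta^2. Equality forces d_u d_v = c for all adjacent
   u and v, hence both degrees are extremal, and by connectedness every vertex has a neighbour. *)
theory Submission
  imports Defs
begin

context graph
begin

lemma adj_sym: "u \<rightarrow> v \<Longrightarrow> v \<rightarrow> u"
  by (rule arcs_ends_symmetric[OF sym_arcs])

lemma finite_arcs_ends: "finite (arcs_ends G)"
  by (simp add: arcs_ends_def)

lemma finite_edges: "finite (edges G)"
proof -
  have "edges G = (\<lambda>(u, v). {u, v}) ` arcs_ends G"
    by (auto simp: edges_def)
  then show ?thesis
    by (simp add: finite_arcs_ends)
qed

text \<open>An edge with an ordering of its two ends is the same thing as an adjacent ordered pair.
  The arguments of \<open>f\<close> are swapped so that, for \<open>SDD\<close>, the vertex in the
  denominator becomes the first entry of the pair, which is the entry that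
  \<open>sum_arcs_ends_fst\<close> groups by.\<close>

lemma sum_edges_eq_sum_arcs_ends:
  fixes f :: "'a \<Rightarrow> 'a \<Rightarrow> 'c::comm_monoid_add"
  shows "(\<Sum>e \<in> edges G. \<Sum>u \<in> e. \<Sum>v \<in> e - {u}. f u v) = (\<Sum>(u, v) \<in> arcs_ends G. f v u)"
proof -
  have fin: "finite e" if "e \<in> edges G" for e
    using that by (auto simp: edges_def)
  have "(\<Sum>e \<in> edges G. \<Sum>u \<in> e. \<Sum>v \<in> e - {u}. f u v)
      = (\<Sum>e \<in> edges G. \<Sum>(u, v) \<in> (SIGMA u:e. e - {u}). f u v)"
    by (intro sum.cong refl sum.Sigma) (auto simp: fin)
  also have "\<dots> = (\<Sum>(e, u, v) \<in> (SIGMA e:edges G. SIGMA u:e. e - {u}). f u v)"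
    by (rule sum.Sigma) (auto simp: fin finite_edges)
  also have "\<dots> = (\<Sum>(u, v) \<in> arcs_ends G. f v u)"
    \<comment> \<open>Symmetry of adjacency makes the swap legitimate; absence of loops ensures that
      the second end survives in \<open>e - {u}\<close>.\<close>
    by (rule sum.reindex_bij_witness[where i = "\<lambda>(u, v). ({u, v}, v, u)"
          and j = "\<lambda>(e, u, v). (v, u)"])
      (auto simp: edges_def dest: adj_sym adj_not_same)
  finally show ?thesis .
qed

text \<open>Since there are no parallel arcs, an arc leaving \<open>u\<close> is determined by its
  head.\<close>

lemma out_degree_eq_card_neighbours: "out_degree G u = card {v. u \<rightarrow> v}"
proof -
  have "bij_betw (head G) (out_arcs G u) {v. u \<rightarrow> v}"
    by (rule bij_betw_imageI)
      (auto simp: inj_on_def arcs_ends_conv arc_to_ends_def intro!: no_multi_arcs)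
  then show ?thesis
    by (simp add: out_degree_def bij_betw_same_card)
qed

text \<open>The pairs with first entry \<open>u\<close> correspond to the neighbours of
  \<open>u\<close>. This is what turns a sum over vertices such as \<open>ID\<close> into a sum over
  adjacent pairs.\<close>

lemma sum_arcs_ends_fst:
  fixes g :: "'a \<Rightarrow> 'c::semiring_1"
  shows "(\<Sum>(u, v) \<in> arcs_ends G. g u) = (\<Sum>u \<in> verts G. of_nat (out_degree G u) * g u)"
proof -
  have Sigma: "arcs_ends G = (SIGMA u:verts G. {v. u \<rightarrow> v})"
    by (auto dest: adj_in_verts)
  have "finite {v. u \<rightarrow> v}" for u
    by (rule finite_subset[of _ "verts G"]) (auto dest: adj_in_verts)
  then have "(\<Sum>(u, v) \<in> (SIGMA u:verts G. {v. u \<rightarrow> v}). g u)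
      = (\<Sum>u \<in> verts G. \<Sum>v \<in> {v. u \<rightarrow> v}. g u)"
    by (intro sum.Sigma[symmetric]) auto
  then show ?thesis
    by (simp add: Sigma[symmetric] out_degree_eq_card_neighbours)
qed

lemma out_degree_pos_iff: "0 < out_degree G u \<longleftrightarrow> (\<exists>v. u \<rightarrow> v)"
  by (fastforce simp: out_degree_def card_gt_0_iff arcs_ends_conv)

text \<open>An edge provides a vertex other than \<open>u\<close>, and a path from \<open>u\<close>
  to it must begin with an arc at \<open>u\<close>.\<close>

lemma connected_imp_out_degree_pos:
  assumes "connected G" and "edges G \<noteq> {}" and "u \<in> verts G"
  shows "0 < out_degree G u"
proof -
  obtain x y where xy: "x \<rightarrow> y"
    using assms(2) by (auto simp: edges_def)
  \<comment> \<open>The vertex \<open>w\<close> is \<open>y\<close> if \<open>x = u\<close>, and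
    \<open>x\<close> otherwise.\<close>
  obtain w where w: "w \<in> verts G" "w \<noteq> u"
    using adj_not_same xy adj_in_verts[OF xy] by (cases "x = u") auto
  have "u \<rightarrow>\<^sup>* w"
    using symmetric_connected_imp_strongly_connected[OF sym_arcs assms(1)] assms(3) w
    by (auto simp: strongly_connected_def)
  then have "\<exists>v. u \<rightarrow> v"
    using w by (cases rule: converse_reachable_cases) auto
  then show ?thesis
    by (simp add: out_degree_pos_iff)
qed

lemma SDD_minus_ID:
  assumes pos: "\<And>u. u \<in> verts G \<Longrightarrow> 0 < out_degree G u"
  shows "SDD G - c * ID G =
    (\<Sum>(u, v) \<in> arcs_ends G. (real (out_degree G u * out_degree G v) - c) / (real (out_degree G u))\<^sup>2)"
proof -
  let ?d = "\<lambda>u. real (out_degree G u)"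
  \<comment> \<open>Splitting off the factor \<open>?d u\<close> gives the shape of
    \<open>sum_arcs_ends_fst\<close>; this is where the squared denominator comes from.\<close>
  have "ID G = (\<Sum>u \<in> verts G. ?d u * (1 / (?d u)\<^sup>2))"
    unfolding ID_def by (intro sum.cong refl) (simp add: power2_eq_square)
  then have "c * ID G = (\<Sum>(u, v) \<in> arcs_ends G. c / (?d u)\<^sup>2)"
    by (simp only: sum_arcs_ends_fst[symmetric] sum_distrib_left) (simp add: case_prod_unfold)
  moreover have "SDD G = (\<Sum>(u, v) \<in> arcs_ends G. ?d v / ?d u)"
    unfolding SDD_def by (rule sum_edges_eq_sum_arcs_ends)
  ultimately have "SDD G - c * ID G = (\<Sum>(u, v) \<in> arcs_ends G. ?d v / ?d u - c / (?d u)\<^sup>2)"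
    by (simp add: sum_subtractf case_prod_unfold)
  also have "\<dots> = (\<Sum>(u, v) \<in> arcs_ends G. (real (out_degree G u * out_degree G v) - c) / (?d u)\<^sup>2)"
    by (intro sum.cong refl)
      (auto simp: power2_eq_square diff_divide_distrib dest!: pos adj_in_verts(1))
  finally show ?thesis .
qed

lemma
  assumes "u \<in> verts G"
  shows min_degree_le: "min_degree G \<le> out_degree G u"
    and max_degree_ge: "out_degree G u \<le> max_degree G"
  using assms by (simp_all add: min_degree_def max_degree_def)

text \<open>Every term of the sum in \<open>SDD_minus_ID\<close> is nonnegative here, so the sum is
  nonnegative and vanishes only if all terms do. The intended \<open>c\<close> is the square of the
  minimum degree.\<close>

lemma
  assumes pos: "\<And>u. u \<in> verts G \<Longrightarrow> 0 < out_degree G u"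
    and c: "\<And>u v. u \<rightarrow> v \<Longrightarrow> c \<le> real (out_degree G u * out_degree G v)"
  shows ID_le_SDD: "c * ID G \<le> SDD G"
    and ID_eq_SDD_iff:
      "c * ID G = SDD G \<longleftrightarrow> (\<forall>u v. u \<rightarrow> v \<longrightarrow> real (out_degree G u * out_degree G v) = c)"
proof -
  let ?t = "\<lambda>(u, v). (real (out_degree G u * out_degree G v) - c) / (real (out_degree G u))\<^sup>2"
  have nonneg: "0 \<le> ?t p" if "p \<in> arcs_ends G" for p
    using that c by (auto split: prod.split)
  have diff: "SDD G - c * ID G = sum ?t (arcs_ends G)"
    by (rule SDD_minus_ID[OF pos])
  show "c * ID G \<le> SDD G"
    using diff sum_nonneg[of "arcs_ends G" ?t] nonneg by auto
  have "c * ID G = SDD G \<longleftrightarrow> sum ?t (arcs_ends G) = 0"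
    using diff by auto
  also have "\<dots> \<longleftrightarrow> (\<forall>p \<in> arcs_ends G. ?t p = 0)"
    by (rule sum_nonneg_eq_0_iff[OF finite_arcs_ends nonneg])
  also have "\<dots> \<longleftrightarrow> (\<forall>u v. u \<rightarrow> v \<longrightarrow> real (out_degree G u * out_degree G v) = c)"
    \<comment> \<open>The denominators are positive, so a term vanishes exactly when its numerator
      does.\<close>
    by (fastforce dest: pos adj_in_verts(1))
  finally show "c * ID G = SDD G \<longleftrightarrow> (\<forall>u v. u \<rightarrow> v \<longrightarrow> real (out_degree G u * out_degree G v) = c)" .
qed

text \<open>The mirror image for the square of the maximum degree: the terms are negated so that
  they are nonnegative again.\<close>

lemma
  assumes pos: "\<And>u. u \<in> verts G \<Longrightarrow> 0 < out_degree G u"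
    and c: "\<And>u v. u \<rightarrow> v \<Longrightarrow> real (out_degree G u * out_degree G v) \<le> c"
  shows SDD_le_ID: "SDD G \<le> c * ID G"
    and SDD_eq_ID_iff:
      "SDD G = c * ID G \<longleftrightarrow> (\<forall>u v. u \<rightarrow> v \<longrightarrow> real (out_degree G u * out_degree G v) = c)"
proof -
  let ?t = "\<lambda>(u, v). (c - real (out_degree G u * out_degree G v)) / (real (out_degree G u))\<^sup>2"
  have nonneg: "0 \<le> ?t p" if "p \<in> arcs_ends G" for p
    using that c by (auto split: prod.split)
  have "sum ?t (arcs_ends G) = - (\<Sum>(u, v) \<in> arcs_ends G.
      (real (out_degree G u * out_degree G v) - c) / (real (out_degree G u))\<^sup>2)"
    by (simp add: case_prod_unfold sum_negf[symmetric] minus_divide_left)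
  then have diff: "c * ID G - SDD G = sum ?t (arcs_ends G)"
    using SDD_minus_ID[OF pos, of c] by linarith
  show "SDD G \<le> c * ID G"
    using diff sum_nonneg[of "arcs_ends G" ?t] nonneg by auto
  have "SDD G = c * ID G \<longleftrightarrow> sum ?t (arcs_ends G) = 0"
    using diff by auto
  also have "\<dots> \<longleftrightarrow> (\<forall>p \<in> arcs_ends G. ?t p = 0)"
    by (rule sum_nonneg_eq_0_iff[OF finite_arcs_ends nonneg])
  also have "\<dots> \<longleftrightarrow> (\<forall>u v. u \<rightarrow> v \<longrightarrow> real (out_degree G u * out_degree G v) = c)"
    by (fastforce dest: pos adj_in_verts(1))
  finally show "SDD G = c * ID G \<longleftrightarrow> (\<forall>u v. u \<rightarrow> v \<longrightarrow> real (out_degree G u * out_degree G v) = c)" .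
qed

lemma regular_imp_extremal:
  assumes "regular G" and "u \<in> verts G"
  shows "out_degree G u = min_degree G" and "out_degree G u = max_degree G"
proof -
  obtain k where k: "\<forall>u \<in> verts G. out_degree G u = k"
    using assms(1) by (auto simp: regular_def)
  \<comment> \<open>The vertex \<open>u\<close> makes the image nonempty, so \<open>Min\<close> and
    \<open>Max\<close> are both \<open>k\<close>.\<close>
  then have "out_degree G ` verts G = {k}"
    using assms(2) by auto
  then show "out_degree G u = min_degree G" "out_degree G u = max_degree G"
    using k assms(2) by (simp_all add: min_degree_def max_degree_def)
qed

text \<open>For the converse, let \<delta> be the minimum degree and \<open>v\<close> a neighbour of
  \<open>u\<close>. Then \<delta> d_u \<le> d_v d_u = \<delta>^2, and cancelling \<delta> gives d_u
  \<le> \<delta>.\<close>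

lemma regular_iff_min_degree:
  assumes pos: "\<And>u. u \<in> verts G \<Longrightarrow> 0 < out_degree G u"
  shows "regular G \<longleftrightarrow> (\<forall>u v. u \<rightarrow> v \<longrightarrow> out_degree G u * out_degree G v = (min_degree G)\<^sup>2)"
    (is "_ \<longleftrightarrow> ?R")
proof
  assume "regular G"
  then show ?R
    by (auto simp: regular_imp_extremal(1) adj_in_verts power2_eq_square)
next
  assume R: ?R
  have "out_degree G u = min_degree G" if u: "u \<in> verts G" for u
  proof -
    obtain v where v: "u \<rightarrow> v"
      using pos[OF u] out_degree_pos_iff by blast
    have "min_degree G * out_degree G u \<le> out_degree G v * out_degree G u"
      by (intro mult_right_mono min_degree_le adj_in_verts(2)[OF v]) simp
    also have "\<dots> = min_degree G * min_degree G"
      using R v by (simp add: power2_eq_square mult.commute)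
    finally have "min_degree G * out_degree G u \<le> min_degree G * min_degree G" .
    \<comment> \<open>The square of the minimum degree is a product of two positive degrees.\<close>
    moreover have "0 < min_degree G"
      using R v pos adj_in_verts[OF v] by (metis gr0I mult_is_0 power2_eq_square less_irrefl)
    ultimately show ?thesis
      using min_degree_le[OF u] by simp
  qed
  then show "regular G"
    by (auto simp: regular_def)
qed

text \<open>Dually, with \<Delta> the maximum degree, \<Delta>^2 = d_v d_u \<le> \<Delta> d_u for a
  neighbour \<open>v\<close> of \<open>u\<close>, so \<Delta> \<le> d_u.\<close>

lemma regular_iff_max_degree:
  assumes pos: "\<And>u. u \<in> verts G \<Longrightarrow> 0 < out_degree G u"
  shows "regular G \<longleftrightarrow> (\<forall>u v. u \<rightarrow> v \<longrightarrow> out_degree G u * out_degree G v = (max_degree G)\<^sup>2)"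
    (is "_ \<longleftrightarrow> ?R")
proof
  assume "regular G"
  then show ?R
    by (auto simp: regular_imp_extremal(2) adj_in_verts power2_eq_square)
next
  assume R: ?R
  have "out_degree G u = max_degree G" if u: "u \<in> verts G" for u
  proof -
    obtain v where v: "u \<rightarrow> v"
      using pos[OF u] out_degree_pos_iff by blast
    have "max_degree G * max_degree G = out_degree G v * out_degree G u"
      using R v by (simp add: power2_eq_square mult.commute)
    also have "\<dots> \<le> max_degree G * out_degree G u"
      by (intro mult_right_mono max_degree_ge adj_in_verts(2)[OF v]) simp
    finally have "max_degree G * max_degree G \<le> max_degree G * out_degree G u" .
    moreover have "0 < max_degree G"
      using pos[OF u] max_degree_ge[OF u] by simp
    ultimately show ?thesis
      using max_degree_ge[OF u] by simp
  qed
  then show "regular G"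
    by (auto simp: regular_def)
qed

end

theorem theorem3p3:
  fixes G :: "('a, 'b) pre_digraph"
  assumes "graph G"
    and "Digraph_Component.connected G"
    and "edges G \<noteq> {}"
  shows "(real (min_degree G))\<^sup>2 * ID G \<le> SDD G \<and>
    SDD G \<le> (real (max_degree G))\<^sup>2 * ID G \<and>
    ((real (min_degree G))\<^sup>2 * ID G = SDD G \<longleftrightarrow> regular G) \<and>
    (SDD G = (real (max_degree G))\<^sup>2 * ID G \<longleftrightarrow> regular G)"
proof -
  interpret graph G by fact
  have pos: "0 < out_degree G u" if "u \<in> verts G" for u
    using connected_imp_out_degree_pos assms(2,3) that .
  have lower: "(real (min_degree G))\<^sup>2 \<le> real (out_degree G u * out_degree G v)" if "u \<rightarrow>\<^bsub>G\<^esub> v" for u v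
    using that by (auto simp: power2_eq_square intro!: mult_mono min_degree_le dest: adj_in_verts)
  have upper: "real (out_degree G u * out_degree G v) \<le> (real (max_degree G))\<^sup>2" if "u \<rightarrow>\<^bsub>G\<^esub> v" for u v
    using that by (auto simp: power2_eq_square intro!: mult_mono max_degree_ge dest: adj_in_verts)
  \<comment> \<open>The equality criteria are stated over the reals and the regularity criteria over
    the naturals; moving the casts outwards makes them match.\<close>
  show ?thesis
    using ID_le_SDD[OF pos lower] SDD_le_ID[OF pos upper]
      ID_eq_SDD_iff[OF pos lower] SDD_eq_ID_iff[OF pos upper]
      regular_iff_min_degree[OF pos] regular_iff_max_degree[OF pos]
    by (simp flip: of_nat_power of_nat_mult)
qed

end
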